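(* Let $\gamma$ be a primitive root modulo $\ell$, set $A=4\gamma N$, and let $t_\gamma$ be the Frobenius trace of $$\mathcal E_\gamma:\quad Y^2=(X^2-1)(X^2-\gamma).$$ Then $$|U_{\gamma,\gamma^2}(N;\ell)|=\begin{cases}\dfrac{3\ell+1+t_\gamma-2\chi(1-\gamma)}{4}, & A\text{ a square},\\[1em] \dfrac{3\ell+1-t_\gamma+2\chi(\gamma-1)}{4}, & A\text{ a nonsquare}.\end{cases}$$ Consequently, for fixed $\ell$ and $\gamma$, the local primitive-root two-target sieve $U_{\gamma,\gamma^2}(N;\ell)$ has an exactly two-valued size distribution as $N$ ranges over $\mathbb F_\ell^*$.
   Context: $\ell>2$ is an odd prime, $\mathbb F_\ell$ is identified with $\mathbb Z/\ell\mathbb Z$, $\mathbb F_\ell^*=\mathbb F_\ell\setminus\{0\}$, and $N$ is an integer whose image modulo $\ell$ lies in $\mathbb F_\ell^*$ (identified with that image). $\chi$ denotes the Legendre symbol modulo $\ell$, with $\chi(0)=0$. A primitive root modulo $\ell$ is a generator of the cyclic group $\mathbb F_\ell^*$. For $a,b\in\mathbb F_\ell^*$, $H_a(N;\ell)=\{ax+Nx^{-1}:x\in\mathbb F_\ell^*\}\subseteq\mathbb F_\ell$ and $U_{a,b}(N;\ell)=H_a(N;\ell)\cup H_b(N;\ell)$; the local primitive-root two-target sieve is the case $a=\gamma$, $b=\gamma^2$. "Square" and "nonsquare" refer to $\mathbb F_\ell^*$. The curve $\mathcal E_\gamma$ is understood as the smooth projective model over $\mathbb F_\ell$ of the given affine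 equation, that is, the nonsingular projective curve over $\mathbb F_\ell$ birational to it. The Frobenius trace of a smooth projective genus-one curve $E/\mathbb F_\ell$ is $t_E=\ell+1-\#E(\mathbb F_\ell)$.
   Formalization: "Exactly two-valued" fails for ℓ=3, γ=2 (both sizes are 3); instead it is proved that the size takes one value when A is a square and one when A is a nonsquare, each for (ℓ−1)/2 residues N, and that the two values differ iff t_γ ≠ χ(1−γ)+χ(γ−1). *)

theory Defs
  imports
    "HOL-Analysis.Cartesian_Space"
    "HOL-Number_Theory.Residues"
    "Berlekamp_Zassenhaus.Finite_Field"
begin

definition legendre_char :: "'p::prime_card mod_ring \<Rightarrow> int" where
  "legendre_char a = Legendre (to_int_mod_ring a) (int CARD('p))"

definition nonzero_square :: "'k::field \<Rightarrow> bool" where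
  "nonzero_square a \<longleftrightarrow> a \<noteq> 0 \<and> (\<exists>b. b \<noteq> 0 \<and> a = b ^ 2)"

definition primitive_root :: "'k::field \<Rightarrow> bool" where
  "primitive_root g \<longleftrightarrow> range (\<lambda>n::int. g powi n) = UNIV - {0}"

definition target_set :: "'k::field \<Rightarrow> 'k \<Rightarrow> 'k set" where
  "target_set a N = {a * x + N * inverse x |x. x \<noteq> 0}"

definition two_target :: "'k::field \<Rightarrow> 'k \<Rightarrow> 'k \<Rightarrow> 'k set" where
  "two_target a b N = target_set a N \<union> target_set b N"

definition affine_quartic :: "'k::field \<Rightarrow> ('k \<times> 'k) set" where
  "affine_quartic g = {(x, y). y ^ 2 = (x ^ 2 - 1) * (x ^ 2 - g)}"

text \<open>
  The naive closure of the affine quartic in the projective plane is singular at infinity. Its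
  smooth projective model is the closure of the image of \<open>(x, y) \<mapsto> [1 : x : x^2 : y]\<close> in
  projective 3-space. With coordinates \<open>[Z : X : W : Y]\<close> it is the intersection of the two
  quadrics \<open>X^2 = Z W\<close> and \<open>Y^2 = (W - Z) (W - g Z)\<close>. The points of projective
  space are encoded as the sets of all nonzero multiples of a nonzero vector.

  The lemmas below justify calling this the smooth projective model. They hold over every field
  \<open>'k\<close>, in particular over an algebraic closure of the field of definition of \<open>g\<close>:
  the Jacobian has full rank 2 at every point if \<open>2 \<noteq> 0\<close> and \<open>g \<noteq> 0, 1\<close>, and mutually inverse morphisms, given by polynomial
  expressions with coefficients in the prime field, identify the affine curve with the part
  \<open>Z \<noteq> 0\<close>. Only the two points \<open>[0 : 0 : 1 : 1]\<close> and \<open>[0 : 0 : 1 : -1]\<close> are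
  omitted; as all components of an intersection of two quadrics in projective 3-space have
  positive dimension, they lie in the closure of the affine part.
\<close>

definition proj_point :: "'k::field ^ 'n \<Rightarrow> ('k ^ 'n) set" where
  "proj_point v = {c *s v |c. c \<noteq> 0}"

definition quadric1 :: "'k::field ^ 4 \<Rightarrow> 'k" where
  "quadric1 v = (v $ 2) ^ 2 - v $ 1 * v $ 3"

definition quadric2 :: "'k::field \<Rightarrow> 'k ^ 4 \<Rightarrow> 'k" where
  "quadric2 g v = (v $ 4) ^ 2 - (v $ 3 - v $ 1) * (v $ 3 - g * v $ 1)"

definition smooth_model :: "'k::field \<Rightarrow> ('k ^ 4) set set" where
  "smooth_model g = {proj_point v |v. v \<noteq> 0 \<and> quadric1 v = 0 \<and> quadric2 g v = 0}"

definition frobenius_trace :: "('k::{field,finite} ^ 'n) set set \<Rightarrow> int" where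
  "frobenius_trace C = int CARD('k) + 1 - int (card C)"

text \<open>
  For a quadratic form \<open>q\<close>, the differential at \<open>v\<close> is the linear form
  \<open>polar q v\<close>.
\<close>

definition polar :: "('k::field ^ 'n \<Rightarrow> 'k) \<Rightarrow> 'k ^ 'n \<Rightarrow> 'k ^ 'n \<Rightarrow> 'k" where
  "polar q v e = q (v + e) - q v - q e"

lemma polar_quadric1: "polar quadric1 v e = 2 * v$2 * e$2 - v$1 * e$3 - v$3 * e$1"
  by (simp add: polar_def quadric1_def algebra_simps power2_eq_square)

lemma polar_quadric2:
  "polar (quadric2 g) v e =
     2 * v$4 * e$4 - (2 * v$3 - (1 + g) * v$1) * e$3 - (2 * g * v$1 - (1 + g) * v$3) * e$1"
  by (simp add: polar_def quadric2_def algebra_simps power2_eq_square)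

lemma vector_4:
  "(vector [a, b, c, d] :: 'k::zero ^ 4) $ 1 = a"
  "(vector [a, b, c, d] :: 'k ^ 4) $ 2 = b"
  "(vector [a, b, c, d] :: 'k ^ 4) $ 3 = c"
  "(vector [a, b, c, d] :: 'k ^ 4) $ 4 = d"
  unfolding vector_def by simp_all

lemma eq_vector4: "(v = (w :: 'k ^ 4)) \<longleftrightarrow> v$1 = w$1 \<and> v$2 = w$2 \<and> v$3 = w$3 \<and> v$4 = w$4"
  by (simp add: vec_eq_iff forall_4)

lemma smooth_model_nonsingular:
  fixes g :: "'k::field" and v :: "'k ^ 4"
  assumes "(2::'k) \<noteq> 0" "g \<noteq> 0" "g \<noteq> 1"
    and "v \<noteq> 0" "quadric1 v = 0" "quadric2 g v = 0"
  shows "\<exists>e. polar quadric1 v e = a \<and> polar (quadric2 g) v e = b"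
proof -
  define z x w y where zd: "z = v$1" and xd: "x = v$2" and wd: "w = v$3" and yd: "y = v$4"
  have q1: "x ^ 2 = z * w" using assms(5) by (simp add: quadric1_def zd xd wd)
  have q2: "y ^ 2 = (w - z) * (w - g * z)"
    using assms(6) by (simp add: quadric2_def zd wd yd)
  have nz: "z \<noteq> 0 \<or> w \<noteq> 0"
  proof (rule ccontr)
    assume "\<not> ?thesis"
    then have "z = 0" "w = 0" by auto
    then have "x = 0" "y = 0" using q1 q2 by auto
    then show False using \<open>z = 0\<close> \<open>w = 0\<close> assms(4) by (simp add: eq_vector4 zd xd wd yd)
  qed
  define A C where Ad: "A = 2 * w - (1 + g) * z" and Cd: "C = 2 * g * z - (1 + g) * w"
  have "\<exists>e1 e2 e3 e4. 2 * x * e2 - z * e3 - w * e1 = a \<and> 2 * y * e4 - A * e3 - C * e1 = b"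
  proof (cases "x = 0"; cases "y = 0")
    assume "x \<noteq> 0" "y \<noteq> 0"
    then show ?thesis using assms(1)
      by (intro exI[of _ 0] exI[of _ "a / (2 * x)"] exI[of _ "b / (2 * y)"]) auto
  next
    assume x: "x = 0" and y: "y \<noteq> 0"
    show ?thesis
    proof (cases "z = 0")
      case True
      then have "w \<noteq> 0" using nz by simp
      then show ?thesis using assms(1) y x True
        by (intro exI[of _ "- a / w"] exI[of _ 0] exI[of _ "0"]
             exI[of _ "(b - C * a / w) / (2 * y)"]) auto
    next
      case False
      then have "w = 0" using q1 x by simp
      then show ?thesis using assms(1) y x False
        by (intro exI[of _ 0] exI[of _ 0] exI[of _ "- a / z"]
             exI[of _ "(b - A * a / z) / (2 * y)"]) auto
    qed
  next
    assume x: "x \<noteq> 0" and y: "y = 0"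
    have "A \<noteq> 0"
    proof
      assume "A = 0"
      moreover have "(w = z \<or> w = g * z)" using q2 y by simp
      ultimately have "(1 - g) * z = 0" unfolding Ad by (auto simp: algebra_simps)
      then show False using assms(3) x q1 by simp
    qed
    then show ?thesis using assms(1) x y
      by (intro exI[of _ 0] exI[of _ "(a - z * b / A) / (2 * x)"] exI[of _ "- b / A"] exI[of _ 0])
         auto
  next
    assume x: "x = 0" and y: "y = 0"
    have "z = 0 \<or> w = 0" using q1 x by simp
    moreover have "w = z \<or> w = g * z" using q2 y by simp
    ultimately have "z = 0 \<and> w = 0" using assms(2) by auto
    then show ?thesis using nz by simp
  qed
  then obtain e1 e2 e3 e4 where
    "2 * x * e2 - z * e3 - w * e1 = a" "2 * y * e4 - A * e3 - C * e1 = b" by blast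
  then show ?thesis
    by (intro exI[of _ "vector [e1, e2, e3, e4] :: 'k ^ 4"])
       (simp add: polar_quadric1 polar_quadric2 vector_4 zd xd wd yd Ad Cd)
qed

lemma proj_point_self: "v \<in> proj_point v"
  unfolding proj_point_def by (force intro: exI[of _ 1])

lemma proj_point_eq_iff:
  "proj_point v = proj_point w \<longleftrightarrow> (\<exists>c. c \<noteq> 0 \<and> v = c *s w)"
proof
  assume "proj_point v = proj_point w"
  moreover have "v \<in> proj_point v" by (rule proj_point_self)
  ultimately show "\<exists>c. c \<noteq> 0 \<and> v = c *s w" unfolding proj_point_def by blast
next
  assume "\<exists>c. c \<noteq> 0 \<and> v = c *s w"
  then obtain c where c: "c \<noteq> 0" "v = c *s w" by blast
  have "d *s w = (d / c) *s v" for d using c by (simp add: vector_smult_assoc)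
  then have "\<exists>d'. d *s w = d' *s v \<and> d' \<noteq> 0" if "d \<noteq> 0" for d
    using that c by (intro exI[of _ "d / c"]) auto
  moreover have "\<exists>d'. d *s v = d' *s w \<and> d' \<noteq> 0" if "d \<noteq> 0" for d
    using that c by (intro exI[of _ "d * c"]) (auto simp: vector_smult_assoc)
  ultimately show "proj_point v = proj_point w" unfolding proj_point_def by blast
qed

lemma smooth_model_affine_chart:
  fixes g :: "'k::field"
  shows "bij_betw (\<lambda>(x, y). proj_point (vector [1, x, x ^ 2, y] :: 'k ^ 4))
           (affine_quartic g) {P \<in> smooth_model g. \<forall>v\<in>P. v $ 1 \<noteq> 0}"
proof (rule bij_betwI')
  fix p q assume "p \<in> affine_quartic g" "q \<in> affine_quartic g"
  show "((case p of (x, y) \<Rightarrow> proj_point (vector [1, x, x ^ 2, y] :: 'k ^ 4)) =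
         (case q of (x, y) \<Rightarrow> proj_point (vector [1, x, x ^ 2, y] :: 'k ^ 4))) = (p = q)"
    by (cases p; cases q) (auto simp: proj_point_eq_iff eq_vector4 vector_4)
next
  fix p assume p: "p \<in> affine_quartic g"
  obtain x y where xy: "p = (x, y)" by (cases p)
  have "proj_point (vector [1, x, x ^ 2, y] :: 'k ^ 4) \<in> smooth_model g"
    unfolding smooth_model_def using p
    by (auto simp: xy affine_quartic_def quadric1_def quadric2_def vector_4 eq_vector4
        intro!: exI[of _ "vector [1, x, x ^ 2, y] :: 'k ^ 4"])
  then show "(case p of (x, y) \<Rightarrow> proj_point (vector [1, x, x ^ 2, y] :: 'k ^ 4))
      \<in> {P \<in> smooth_model g. \<forall>v\<in>P. v $ 1 \<noteq> 0}"
    by (auto simp: xy proj_point_def vector_4)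
next
  fix P :: "('k ^ 4) set" assume "P \<in> {P \<in> smooth_model g. \<forall>v\<in>P. v $ 1 \<noteq> 0}"
  then obtain v where v: "P = proj_point v" "quadric1 v = 0" "quadric2 g v = 0"
    and nz: "\<forall>u\<in>proj_point v. u $ 1 \<noteq> 0" unfolding smooth_model_def by blast
  have z: "v $ 1 \<noteq> 0"
    using nz proj_point_self by blast
  define x y where xd: "x = v$2 / v$1" and yd: "y = v$4 / v$1"
  have w: "v $ 3 = v $ 1 * x ^ 2"
    using v(2) z by (simp add: quadric1_def xd power2_eq_square field_simps)
  have "(v$1) ^ 2 * y ^ 2 = (v$1) ^ 2 * ((x ^ 2 - 1) * (x ^ 2 - g))"
  proof -
    have "(v$1) ^ 2 * y ^ 2 = (v$4) ^ 2" using z by (simp add: yd power_divide)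
    also have "\<dots> = (v$3 - v$1) * (v$3 - g * v$1)" using v(3) by (simp add: quadric2_def)
    finally show ?thesis by (simp add: w power2_eq_square algebra_simps)
  qed
  then have "y ^ 2 = (x ^ 2 - 1) * (x ^ 2 - g)" using z by simp
  moreover have "v = v$1 *s vector [1, x, x ^ 2, y]"
    using z by (simp add: eq_vector4 vector_4 w) (simp add: xd yd)
  ultimately show "\<exists>p\<in>affine_quartic g.
      P = (case p of (x, y) \<Rightarrow> proj_point (vector [1, x, x ^ 2, y] :: 'k ^ 4))"
    using z v(1) by (intro bexI[of _ "(x, y)"]) (auto simp: affine_quartic_def proj_point_eq_iff)
qed

lemma smooth_model_at_infinity:
  fixes g :: "'k::field"
  shows "{P \<in> smooth_model g. \<exists>v\<in>P. v $ 1 = 0} =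
    {proj_point (vector [0, 0, 1, 1]), proj_point (vector [0, 0, 1, - 1])}" (is "?L = ?R")
proof
  have "proj_point v \<in> ?L" if "v = vector [0, 0, 1, 1] \<or> v = vector [0, 0, 1, - 1]"
    for v :: "'k ^ 4"
  proof -
    have "v \<noteq> 0 \<and> quadric1 v = 0 \<and> quadric2 g v = 0 \<and> v $ 1 = 0"
      using that by (auto simp: quadric1_def quadric2_def vector_4 eq_vector4)
    then show ?thesis unfolding smooth_model_def using proj_point_self by blast
  qed
  then show "?R \<subseteq> ?L" by blast
  show "?L \<subseteq> ?R"
  proof
    fix P assume "P \<in> ?L"
    then obtain v u where v: "P = proj_point v" "v \<noteq> 0" "quadric1 v = 0" "quadric2 g v = 0"
      and u: "u \<in> proj_point v" "u $ 1 = 0" unfolding smooth_model_def by blast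
    have z: "v $ 1 = 0" using u unfolding proj_point_def by auto
    have x: "v $ 2 = 0" using v(3) z by (simp add: quadric1_def)
    have "(v $ 4) ^ 2 = (v $ 3) ^ 2" using v(4) z by (simp add: quadric2_def power2_eq_square)
    then have y: "v $ 4 = v $ 3 \<or> v $ 4 = - v $ 3" by (simp add: power2_eq_iff)
    then have w: "v $ 3 \<noteq> 0" using v(2) z x by (auto simp: eq_vector4)
    have "v = v$3 *s vector [0, 0, 1, 1] \<or> v = v$3 *s vector [0, 0, 1, - 1]"
      using x y z by (auto simp: eq_vector4 vector_4)
    then show "P \<in> ?R" using w v(1) by (auto simp: proj_point_eq_iff)
  qed
qed

end

theory Submission
  imports Defs
begin

text \<open>
  Clearing denominators, \<open>y = a x + N / x\<close> is a quadratic equation in \<open>x\<close> whose roots are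
  nonzero because \<open>N\<close> is, so \<open>y\<close> is a value of \<open>a x + N / x\<close> iff the discriminant
  \<open>y^2 - 4 a N\<close> is zero or a square. With \<open>A = 4 \<gamma> N\<close>, the complement of the two-target set
  therefore consists of the \<open>y\<close> for which both \<open>y^2 - A\<close> and \<open>y^2 - \<gamma> A\<close> are nonsquares. With
  the quadratic character \<open>\<chi>\<close>, four times the indicator of this condition is
  \<open>(1 - \<chi> (y^2 - A)) (1 - \<chi> (y^2 - \<gamma> A))\<close>, except at the at most four zeros of
  \<open>(y^2 - A) (y^2 - \<gamma> A)\<close>. Expanding (lemma \<open>card_both_nonsquares\<close>), the linear terms are
  the sums \<open>\<Sum>y. \<chi> (y^2 - c) = -1\<close>, and what remains is the quartic sum
  \<open>\<Sum>y. \<chi> ((y^2 - A) (y^2 - \<gamma> A))\<close>.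

  Let \<open>S\<close> be this sum for \<open>A = 1\<close>. Over each \<open>x\<close> the quartic has \<open>1 + \<chi> ((x^2 - 1) (x^2 - \<gamma>))\<close>
  affine points, which makes \<open>l + S\<close> in total, and there are two more points at infinity; so the
  Frobenius trace is \<open>- 1 - S\<close>. If \<open>A = s^2\<close>, the substitution \<open>y = s x\<close> turns the quartic
  sum into \<open>S\<close>. A primitive root is a nonsquare; so if \<open>A\<close> is a nonsquare, then \<open>\<gamma> A = s^2\<close>, and the
  substitution \<open>y = s / x\<close> turns the quartic sum into \<open>- S\<close>, up to the contributions of \<open>x = 0\<close>
  and \<open>y = 0\<close>. Hence \<open>N\<close> enters only through \<open>\<chi> A\<close>; half of all \<open>A \<noteq> 0\<close> are squares, so both
  cases occur.
\<close>

section \<open>The quadratic character of a finite field\<close>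

definition quad_char :: "'k::field \<Rightarrow> int" where
  "quad_char a = (if a = 0 then 0 else if \<exists>b. a = b ^ 2 then 1 else - 1)"

lemma quad_char_0 [simp]: "quad_char 0 = 0"
  by (simp add: quad_char_def)

lemma quad_char_eq_0_iff [simp]: "quad_char a = 0 \<longleftrightarrow> a = 0"
  by (simp add: quad_char_def)

lemma quad_char_square [simp]: "b \<noteq> 0 \<Longrightarrow> quad_char (b ^ 2) = 1"
  by (auto simp: quad_char_def)

lemma quad_char_cases: "quad_char a = 0 \<or> quad_char a = 1 \<or> quad_char a = - 1"
  by (simp add: quad_char_def)

lemma nonzero_square_iff: "nonzero_square a \<longleftrightarrow> quad_char a = 1"
  by (auto simp: nonzero_square_def quad_char_def)

lemma quad_char_eq_1E:
  assumes "quad_char a = 1"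
  obtains s where "s \<noteq> 0" "a = s ^ 2"
  using assms by (auto simp: quad_char_def split: if_splits)

lemma card_square_roots:
  fixes a :: "'k::{field,finite}"
  assumes two: "(2::'k) \<noteq> 0"
  shows "int (card {x. x ^ 2 = a}) = 1 + quad_char a"
proof (cases "\<exists>b. a = b ^ 2")
  case True
  then obtain b where b: "a = b ^ 2" by blast
  have eq: "{x. x ^ 2 = a} = {b, - b}" by (auto simp: b power2_eq_iff)
  show ?thesis
  proof (cases "b = 0")
    case True
    then show ?thesis using eq b by simp
  next
    case False
    have "b \<noteq> - b"
    proof
      assume "b = - b"
      then have "2 * b = 0" by (metis add.right_inverse mult_2)
      then show False using two False by simp
    qed
    then show ?thesis using False by (simp add: eq) (simp add: b)
  qed
next
  case False
  then have "{x. x ^ 2 = a} = {}" "a \<noteq> 0" by (auto intro: exI[of _ 0])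
  then show ?thesis using False by (simp add: quad_char_def)
qed

lemma card_square_fibration:
  fixes f :: "'k::{field,finite} \<Rightarrow> 'k"
  assumes two: "(2::'k) \<noteq> 0"
  shows "int (card {(x, y). y ^ 2 = f x}) = int CARD('k) + (\<Sum>x\<in>UNIV. quad_char (f x))"
proof -
  have "{(x, y). y ^ 2 = f x} = (SIGMA x:UNIV. {y. y ^ 2 = f x})" by auto
  then have "int (card {(x, y). y ^ 2 = f x}) = (\<Sum>x\<in>UNIV. int (card {y. y ^ 2 = f x}))"
    by simp
  then show ?thesis by (simp add: card_square_roots[OF two] sum.distrib)
qed

text \<open>
  The pairs \<open>(y^2, y)\<close> are as many as the elements of the field; counted by their first
  component, they are as many plus the character sum.
\<close>

lemma sum_quad_char:
  assumes two: "(2::'k::{field,finite}) \<noteq> 0"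
  shows "(\<Sum>a\<in>(UNIV::'k set). quad_char a) = 0"
proof -
  have "{(x::'k, y). y ^ 2 = x} = (\<lambda>y. (y ^ 2, y)) ` UNIV" by auto
  then have "card {(x::'k, y). y ^ 2 = x} = CARD('k)"
    by (simp add: card_image inj_on_def)
  then show ?thesis using card_square_fibration[OF two, of "\<lambda>x. x"] by simp
qed

lemma card_quad_char_eq:
  assumes two: "(2::'k::{field,finite}) \<noteq> 0"
  shows "2 * card {a::'k. quad_char a = 1} = CARD('k) - 1"
    and "2 * card {a::'k. quad_char a = - 1} = CARD('k) - 1"
proof -
  let ?Q = "{a::'k. quad_char a = 1}" and ?R = "{a::'k. quad_char a = - 1}"
  have "quad_char a = of_bool (a \<in> ?Q) - of_bool (a \<in> ?R)" for a :: 'k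
    using quad_char_cases[of a] by auto
  then have "(\<Sum>a\<in>(UNIV::'k set). quad_char a) =
      (\<Sum>a\<in>(UNIV::'k set). of_bool (a \<in> ?Q) - of_bool (a \<in> ?R))"
    by (intro sum.cong refl)
  also have "\<dots> = int (card ?Q) - int (card ?R)"
    by (simp add: sum_subtractf)
  finally have eq: "card ?Q = card ?R" using sum_quad_char[OF two] by simp
  have "UNIV - {0} = ?Q \<union> ?R"
    using quad_char_cases by auto
  then have "card (UNIV - {0::'k}) = card (?Q \<union> ?R)" by (rule arg_cong)
  also have "\<dots> = card ?Q + card ?R" by (intro card_Un_disjoint) auto
  finally have "CARD('k) - 1 = card ?Q + card ?R" by (simp add: card_Diff_subset)
  then show "2 * card ?Q = CARD('k) - 1" "2 * card ?R = CARD('k) - 1" using eq by auto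
qed

text \<open>
  The only case that is not formal is the product of two nonsquares. Multiplication by a nonsquare
  maps the squares injectively into the nonsquares, hence onto them, as there are equally many;
  so it cannot map a further element, a nonsquare, to a nonsquare.
\<close>

lemma quad_char_mult:
  fixes a b :: "'k::{field,finite}"
  assumes two: "(2::'k) \<noteq> 0"
  shows "quad_char (a * b) = quad_char a * quad_char b"
proof -
  have sq: "quad_char (s ^ 2 * b) = quad_char b" if s: "s \<noteq> 0" for s b :: 'k
  proof -
    have "(\<exists>c. s ^ 2 * b = c ^ 2) \<longleftrightarrow> (\<exists>c. b = c ^ 2)"
    proof
      assume "\<exists>c. s ^ 2 * b = c ^ 2"
      then obtain c where "s ^ 2 * b = c ^ 2" by blast
      then have "b = (c / s) ^ 2" using s by (simp add: power_divide field_simps)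
      then show "\<exists>c. b = c ^ 2" by blast
    next
      assume "\<exists>c. b = c ^ 2"
      then show "\<exists>c. s ^ 2 * b = c ^ 2" by (metis power_mult_distrib)
    qed
    then show ?thesis using s by (simp add: quad_char_def)
  qed
  let ?Q = "{a::'k. quad_char a = 1}" and ?R = "{a::'k. quad_char a = - 1}"
  have nonsq: "quad_char (a * b) = 1" if a: "quad_char a = - 1" and b: "quad_char b = - 1"
    for a b :: 'k
  proof -
    have a0: "a \<noteq> 0" and b0: "b \<noteq> 0" using a b by auto
    have sub: "(\<lambda>x. a * x) ` ?Q \<subseteq> ?R"
    proof clarsimp
      fix q :: 'k assume "quad_char q = 1"
      then obtain s where s: "s \<noteq> 0" "q = s ^ 2" by (rule quad_char_eq_1E)
      show "quad_char (a * q) = - 1" using sq[OF s(1), of a] a by (simp add: s mult.commute)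
    qed
    have "card ((\<lambda>x. a * x) ` ?Q) = card ?Q"
      using a0 by (intro card_image) (simp add: inj_on_def)
    also have "\<dots> = card ?R" using card_quad_char_eq[OF two] by simp
    finally have im: "(\<lambda>x. a * x) ` ?Q = ?R" using sub by (intro card_subset_eq) auto
    have "a * b \<notin> ?R"
    proof
      assume "a * b \<in> ?R"
      then obtain q where "q \<in> ?Q" "a * b = a * q" using im by blast
      then show False using a0 b by auto
    qed
    then show ?thesis using quad_char_cases[of "a * b"] a0 b0 by auto
  qed
  consider "a = 0 \<or> b = 0" | "quad_char a = 1" | "quad_char b = 1"
    | "quad_char a = - 1" "quad_char b = - 1"
    using quad_char_cases[of a] quad_char_cases[of b] by auto
  then show ?thesis
  proof cases
    case 1 then show ?thesis by auto
  next
    case 2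
    then obtain s where "s \<noteq> 0" "a = s ^ 2" by (rule quad_char_eq_1E)
    then show ?thesis using sq[of s b] 2 by simp
  next
    case 3
    then obtain s where "s \<noteq> 0" "b = s ^ 2" by (rule quad_char_eq_1E)
    then show ?thesis using sq[of s a] 3 by (simp add: mult.commute)
  next
    case 4
    then show ?thesis using nonsq by simp
  qed
qed

lemma half_sum_plus_half_diff:
  fixes a b :: "'k::field"
  assumes two: "(2::'k) \<noteq> 0"
  shows "(a + b) / 2 + (a - b) / 2 = a" and "(a + b) / 2 - (a - b) / 2 = b"
proof -
  have "(a + b) + (a - b) = 2 * a" "(a + b) - (a - b) = 2 * b" by simp_all
  then show "(a + b) / 2 + (a - b) / 2 = a" "(a + b) / 2 - (a - b) / 2 = b"
    unfolding add_divide_distrib[symmetric] diff_divide_distrib[symmetric]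
    using two by (simp_all only:) simp_all
qed

text \<open>
  The hyperbola \<open>z^2 = y^2 - c\<close> is \<open>u v = c\<close> in the coordinates \<open>u = y + z\<close> and \<open>v = y - z\<close>;
  it has one point for each \<open>u \<noteq> 0\<close>.
\<close>

lemma sum_quad_char_square_diff:
  fixes c :: "'k::{field,finite}"
  assumes two: "(2::'k) \<noteq> 0" and c: "c \<noteq> 0"
  shows "(\<Sum>y\<in>UNIV. quad_char (y ^ 2 - c)) = - 1"
proof -
  have factor: "z ^ 2 = y ^ 2 - c \<longleftrightarrow> (y + z) * (y - z) = c" for y z
    by (auto simp: power2_eq_square algebra_simps)
  have "bij_betw (\<lambda>(y, z). y + z) {(y, z). z ^ 2 = y ^ 2 - c} (UNIV - {0})"
  proof (rule bij_betw_byWitness[where f' = "\<lambda>u. ((u + c / u) / 2, (u - c / u) / 2)"])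
    have "((y + z) + c / (y + z)) / 2 = y \<and> ((y + z) - c / (y + z)) / 2 = z"
      if "z ^ 2 = y ^ 2 - c" for y z
    proof -
      have yz: "(y + z) * (y - z) = c" using that factor by simp
      then have "y + z \<noteq> 0" using c by auto
      then have "c / (y + z) = y - z" unfolding yz[symmetric] by simp
      moreover have "(y + z) + (y - z) = 2 * y" "(y + z) - (y - z) = 2 * z" by simp_all
      ultimately show ?thesis using two by (simp only:) simp
    qed
    then show "\<forall>p\<in>{(y, z). z ^ 2 = y ^ 2 - c}.
        (\<lambda>u. ((u + c / u) / 2, (u - c / u) / 2)) ((\<lambda>(y, z). y + z) p) = p"
      by auto
    show "\<forall>u\<in>UNIV - {0}. (\<lambda>(y, z). y + z) ((u + c / u) / 2, (u - c / u) / 2) = u"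
      by (simp only: half_sum_plus_half_diff[OF two] prod.case) simp
    show "(\<lambda>(y, z). y + z) ` {(y, z). z ^ 2 = y ^ 2 - c} \<subseteq> UNIV - {0}"
      using c by (auto simp: factor)
    have "((u - c / u) / 2) ^ 2 = ((u + c / u) / 2) ^ 2 - c" if u: "u \<noteq> 0" for u
      unfolding factor half_sum_plus_half_diff[OF two] using u by simp
    then show "(\<lambda>u. ((u + c / u) / 2, (u - c / u) / 2)) ` (UNIV - {0})
        \<subseteq> {(y, z). z ^ 2 = y ^ 2 - c}"
      by auto
  qed
  then have "card {(y, z). z ^ 2 = y ^ 2 - c} = CARD('k) - 1"
    by (simp add: bij_betw_same_card card_Diff_subset)
  moreover have "CARD('k) > 0" by (simp add: card_gt_0_iff)
  ultimately show ?thesis using card_square_fibration[OF two, of "\<lambda>y. y ^ 2 - c"]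
    by (simp add: of_nat_diff)
qed

section \<open>Pairs of discriminants\<close>

text \<open>
  The product \<open>(1 - \<chi> (y^2 - A)) (1 - \<chi> (y^2 - B))\<close> is 4 on the set to be counted and 0
  elsewhere, except that at a square root \<open>y\<close> of \<open>A\<close> it is \<open>1 - \<chi> (A - B)\<close>, and similarly for
  \<open>B\<close>. The last two terms remove these contributions.
\<close>

lemma card_both_nonsquares:
  fixes A B :: "'k::{field,finite}"
  assumes two: "(2::'k) \<noteq> 0" and A: "A \<noteq> 0" and B: "B \<noteq> 0" and AB: "A \<noteq> B"
  shows "4 * int (card {y. quad_char (y ^ 2 - A) = - 1 \<and> quad_char (y ^ 2 - B) = - 1}) =
    int CARD('k) + 2 + (\<Sum>y\<in>UNIV. quad_char ((y ^ 2 - A) * (y ^ 2 - B)))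
      - (1 + quad_char A) * (1 - quad_char (A - B))
      - (1 + quad_char B) * (1 - quad_char (B - A))"
proof -
  let ?C = "{y. quad_char (y ^ 2 - A) = - 1 \<and> quad_char (y ^ 2 - B) = - 1}"
  have pointwise: "4 * of_bool (y \<in> ?C) =
      1 - quad_char (y ^ 2 - A) - quad_char (y ^ 2 - B)
        + quad_char ((y ^ 2 - A) * (y ^ 2 - B))
        - (1 - quad_char (A - B)) * of_bool (y \<in> {y. y ^ 2 = A})
        - (1 - quad_char (B - A)) * of_bool (y \<in> {y. y ^ 2 = B})" for y
    using AB quad_char_cases[of "y ^ 2 - A"] quad_char_cases[of "y ^ 2 - B"]
    by (auto simp: quad_char_mult[OF two])
  have "4 * int (card ?C) = (\<Sum>y\<in>UNIV. 4 * of_bool (y \<in> ?C))"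
    by (simp add: sum_distrib_left[symmetric])
  also have "\<dots> = int CARD('k) - (\<Sum>y\<in>UNIV. quad_char (y ^ 2 - A))
        - (\<Sum>y\<in>UNIV. quad_char (y ^ 2 - B))
        + (\<Sum>y\<in>UNIV. quad_char ((y ^ 2 - A) * (y ^ 2 - B)))
        - (1 - quad_char (A - B)) * int (card {y. y ^ 2 = A})
        - (1 - quad_char (B - A)) * int (card {y. y ^ 2 = B})"
    unfolding pointwise
    by (simp add: sum.distrib sum_subtractf sum_distrib_left[symmetric])
  finally show ?thesis
    by (simp add: sum_quad_char_square_diff[OF two] A B card_square_roots[OF two])
qed

definition quartic_sum :: "'k::{field,finite} \<Rightarrow> 'k \<Rightarrow> int" where
  "quartic_sum A B = (\<Sum>y\<in>UNIV. quad_char ((y ^ 2 - A) * (y ^ 2 - B)))"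

lemma quartic_sum_scale:
  fixes s A B :: "'k::{field,finite}"
  assumes two: "(2::'k) \<noteq> 0" and s: "s \<noteq> 0"
  shows "quartic_sum (s ^ 2 * A) (s ^ 2 * B) = quartic_sum A B"
proof -
  have "bij_betw (\<lambda>x. s * x) UNIV (UNIV::'k set)"
    using s by (intro bij_betw_byWitness[where f' = "\<lambda>x. x / s"]) auto
  then have "quartic_sum (s ^ 2 * A) (s ^ 2 * B) =
      (\<Sum>x\<in>UNIV. quad_char (((s * x) ^ 2 - s ^ 2 * A) * ((s * x) ^ 2 - s ^ 2 * B)))"
    unfolding quartic_sum_def by (intro sum.reindex_bij_betw[symmetric])
  also have "\<dots> = (\<Sum>x\<in>UNIV. quad_char ((s ^ 2) ^ 2 * ((x ^ 2 - A) * (x ^ 2 - B))))"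
    by (intro sum.cong refl arg_cong[of _ _ quad_char])
       (simp add: power2_eq_square algebra_simps)
  also have "\<dots> = (\<Sum>x\<in>UNIV. quad_char ((s ^ 2) ^ 2) * quad_char ((x ^ 2 - A) * (x ^ 2 - B)))"
    by (simp only: quad_char_mult[OF two, of "(s ^ 2) ^ 2"])
  also have "quad_char ((s ^ 2) ^ 2) = 1" using s by (intro quad_char_square) simp
  finally show ?thesis by (simp only: quartic_sum_def mult_1)
qed

text \<open>
  The substitution \<open>y = s / x\<close> gives
  \<open>(y^2 - A) (y^2 - g A) = g (A / x^2)^2 (x^2 - 1) (x^2 - g)\<close>. The terms outside the product
  correct for \<open>y = 0\<close> and \<open>x = 0\<close>, where the summands are \<open>\<chi> (g A^2) = \<chi> g\<close> and \<open>\<chi> g\<close>.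
\<close>

lemma quartic_sum_invert:
  fixes s A g :: "'k::{field,finite}"
  assumes two: "(2::'k) \<noteq> 0" and A: "A \<noteq> 0" and g: "g \<noteq> 0" and s: "s ^ 2 = g * A"
  shows "quartic_sum A (g * A) = quad_char g + quad_char g * (quartic_sum 1 g - quad_char g)"
proof -
  let ?f = "\<lambda>y. quad_char ((y ^ 2 - A) * (y ^ 2 - g * A))"
  let ?h = "\<lambda>x. quad_char ((x ^ 2 - 1) * (x ^ 2 - g))"
  have s0: "s \<noteq> 0" using s A g by auto
  have bij: "bij_betw (\<lambda>x. s / x) (UNIV - {0}) (UNIV - {0})"
    using s0 by (intro bij_betw_byWitness[where f' = "\<lambda>x. s / x"]) auto
  have subst_x: "?f (s / x) = quad_char g * ?h x" if x: "x \<noteq> 0" for x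
  proof -
    have sx: "(s / x) ^ 2 = g * A / x ^ 2" by (simp add: power_divide s)
    have "((s / x) ^ 2 - A) * ((s / x) ^ 2 - g * A) =
        (A / x ^ 2) ^ 2 * (g * ((x ^ 2 - 1) * (x ^ 2 - g)))"
      unfolding sx using x by (simp add: field_simps power2_eq_square)
    moreover have "A / x ^ 2 \<noteq> 0" using A x by simp
    ultimately show ?thesis
      by (simp only: quad_char_mult[OF two] quad_char_square) simp
  qed
  have "(\<Sum>y\<in>UNIV - {0}. ?f y) = (\<Sum>x\<in>UNIV - {0}. ?f (s / x))"
    using sum.reindex_bij_betw[OF bij, of ?f] by simp
  also have "\<dots> = (\<Sum>x\<in>UNIV - {0}. quad_char g * ?h x)"
    by (intro sum.cong refl) (use subst_x in auto)
  also have "\<dots> = quad_char g * (\<Sum>x\<in>UNIV - {0}. ?h x)"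
    by (simp add: sum_distrib_left)
  also have "(\<Sum>x\<in>UNIV - {0}. ?h x) = quartic_sum 1 g - quad_char g"
    by (simp add: quartic_sum_def sum_diff1)
  finally have off0: "(\<Sum>y\<in>UNIV - {0}. ?f y) = quad_char g * (quartic_sum 1 g - quad_char g)" .
  have "?f 0 = quad_char (A ^ 2 * g)" by (simp add: power2_eq_square algebra_simps)
  also have "\<dots> = quad_char g" using A by (simp add: quad_char_mult[OF two])
  finally show ?thesis
    using off0 by (simp add: quartic_sum_def sum.remove[of UNIV 0 ?f])
qed

section \<open>The Frobenius trace of the quartic\<close>

lemma card_smooth_model:
  fixes g :: "'k::{field,finite}"
  assumes two: "(2::'k) \<noteq> 0"
  shows "card (smooth_model g) = card (affine_quartic g) + 2"
proof -
  let ?F = "{P \<in> smooth_model g. \<forall>v\<in>P. v $ 1 \<noteq> 0}"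
  let ?I = "{P \<in> smooth_model g. \<exists>v\<in>P. v $ 1 = 0}"
  have "card ?F = card (affine_quartic g)"
    using bij_betw_same_card[OF smooth_model_affine_chart[of g]] by simp
  moreover have "card ?I = 2"
  proof -
    have "(1::'k) \<noteq> - 1" using two by (metis add.right_inverse one_add_one)
    then have "proj_point (vector [0, 0, 1, 1] :: 'k ^ 4) \<noteq> proj_point (vector [0, 0, 1, - 1])"
      by (auto simp: proj_point_eq_iff eq_vector4 vector_4)
    then show ?thesis by (simp add: smooth_model_at_infinity)
  qed
  moreover have "card (smooth_model g) = card ?F + card ?I"
    by (subst card_Un_disjoint[symmetric]) (auto intro!: arg_cong[of _ _ card])
  ultimately show ?thesis by simp
qed

lemma frobenius_trace_smooth_model:
  fixes g :: "'k::{field,finite}"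
  assumes two: "(2::'k) \<noteq> 0"
  shows "frobenius_trace (smooth_model g) = - 1 - quartic_sum 1 g"
  using card_square_fibration[OF two, of "\<lambda>x. (x ^ 2 - 1) * (x ^ 2 - g)"]
  by (simp add: frobenius_trace_def card_smooth_model[OF two] affine_quartic_def quartic_sum_def)

section \<open>The size of the two-target set\<close>

lemma target_set_iff_discriminant:
  fixes a N y :: "'k::{field,finite}"
  assumes two: "(2::'k) \<noteq> 0" and a: "a \<noteq> 0" and N: "N \<noteq> 0"
  shows "y \<in> target_set a N \<longleftrightarrow> quad_char (y ^ 2 - 4 * a * N) \<noteq> - 1"
proof
  assume "y \<in> target_set a N"
  then obtain x where x: "x \<noteq> 0" "y = a * x + N * inverse x" by (auto simp: target_set_def)
  define w where "w = N * inverse x"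
  have "y = a * x + w" "N = x * w" using x by (simp_all add: w_def)
  then have "y ^ 2 - 4 * a * N = (a * x - w) ^ 2"
    by (simp add: power2_eq_square algebra_simps)
  then show "quad_char (y ^ 2 - 4 * a * N) \<noteq> - 1"
    by (auto simp: quad_char_def)
next
  assume "quad_char (y ^ 2 - 4 * a * N) \<noteq> - 1"
  then obtain d where d: "y ^ 2 - 4 * a * N = d ^ 2"
    by (auto simp: quad_char_def split: if_splits intro: that[of 0])
  define x where "x = (y + d) / (2 * a)"
  have four: "(4::'k) = 2 * 2" by simp
  have four0: "(4::'k) \<noteq> 0" using two unfolding four by (intro no_zero_divisors)
  have prod: "(y + d) * (y - d) = 4 * a * N"
    using d by (simp add: power2_eq_square algebra_simps)
  have "(4::'k) * a * N \<noteq> 0" using four0 a N by simp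
  then have "y + d \<noteq> 0" using prod by auto
  then have x: "x \<noteq> 0" using two a by (simp add: x_def)
  have "x * ((y - d) / 2) = (y + d) * (y - d) / (4 * a)" by (simp add: x_def)
  also have "\<dots> = N" using prod four0 a by simp
  finally have "N = x * ((y - d) / 2)" by (rule sym)
  then have "N * inverse x = (y - d) / 2" using x by (simp only:) simp
  moreover have "a * x = (y + d) / 2" using a by (simp add: x_def)
  ultimately have "y = a * x + N * inverse x"
    by (simp only: half_sum_plus_half_diff[OF two])
  then show "y \<in> target_set a N" using x by (auto simp: target_set_def)
qed

lemma card_two_target:
  fixes g N :: "'k::{field,finite}"
  assumes two: "(2::'k) \<noteq> 0" and g: "quad_char g = - 1" and N: "N \<noteq> 0"
    and t: "t = frobenius_trace (smooth_model g)"
  shows "4 * int (card (two_target g (g ^ 2) N)) =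
    (if nonzero_square (4 * g * N)
     then 3 * int CARD('k) + 1 + t - 2 * quad_char (1 - g)
     else 3 * int CARD('k) + 1 - t + 2 * quad_char (g - 1))"
proof -
  define A where "A = 4 * g * N"
  have "(2::'k) * 2 \<noteq> 0" using two by (intro no_zero_divisors)
  then have four: "(4::'k) \<noteq> 0" by simp
  have g0: "g \<noteq> 0" using g by auto
  have g1: "g \<noteq> 1" using g quad_char_square[of "1::'k"] by auto
  have A0: "A \<noteq> 0" using four g0 N by (simp add: A_def)
  let ?C = "{y. quad_char (y ^ 2 - A) = - 1 \<and> quad_char (y ^ 2 - g * A) = - 1}"
  have "UNIV - two_target g (g ^ 2) N = ?C"
    using target_set_iff_discriminant[OF two g0 N]
      target_set_iff_discriminant[OF two _ N, of "g ^ 2"] g0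
    by (auto simp: two_target_def A_def power2_eq_square mult_ac)
  moreover have "card (UNIV - two_target g (g ^ 2) N) = CARD('k) - card (two_target g (g ^ 2) N)"
    by (intro card_Diff_subset) auto
  moreover have "card (two_target g (g ^ 2) N) \<le> CARD('k)" by (intro card_mono) auto
  ultimately have compl: "int (card (two_target g (g ^ 2) N)) = int CARD('k) - int (card ?C)"
    by (simp add: of_nat_diff)
  have count: "4 * int (card ?C) = int CARD('k) + 2 + quartic_sum A (g * A)
      - (1 + quad_char A) * (1 - quad_char (A - g * A))
      - (1 - quad_char A) * (1 - quad_char (g * A - A))"
    using card_both_nonsquares[OF two A0, of "g * A"] A0 g0 g1
    by (simp add: quartic_sum_def quad_char_mult[OF two] g)
  have S: "quartic_sum 1 g = - 1 - t" using frobenius_trace_smooth_model[OF two, of g] t by simp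
  show ?thesis
  proof (cases "quad_char A = 1")
    case True
    then obtain s where s: "s \<noteq> 0" "A = s ^ 2" by (rule quad_char_eq_1E)
    have "quartic_sum A (g * A) = - 1 - t"
      using quartic_sum_scale[OF two s(1), of 1 g] S by (simp add: s mult.commute)
    moreover have "quad_char (A - g * A) = quad_char (1 - g)"
    proof -
      have "A - g * A = A * (1 - g)" by (simp add: algebra_simps)
      then show ?thesis by (simp add: quad_char_mult[OF two] True)
    qed
    ultimately show ?thesis
      using count compl True by (simp add: nonzero_square_iff A_def[symmetric])
  next
    case False
    then have A: "quad_char A = - 1" using quad_char_cases[of A] A0 by auto
    then have "quad_char (g * A) = 1" by (simp add: quad_char_mult[OF two] g)
    then obtain s where "s ^ 2 = g * A" by (metis quad_char_eq_1E)
    then have "quartic_sum A (g * A) = t - 1"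
      using quartic_sum_invert[OF two A0 g0] g S by simp
    moreover have "quad_char (g * A - A) = - quad_char (g - 1)"
    proof -
      have "g * A - A = A * (g - 1)" by (simp add: algebra_simps)
      then show ?thesis by (simp add: quad_char_mult[OF two] A)
    qed
    ultimately show ?thesis
      using count compl A by (simp add: nonzero_square_iff A_def[symmetric])
  qed
qed

section \<open>Primitive roots of prime fields\<close>

text \<open>
  If a primitive root were a square, all its powers, hence all nonzero elements would be squares,
  but half of them are not.
\<close>

lemma primitive_root_nonsquare:
  fixes g :: "'k::{field,finite}"
  assumes two: "(2::'k) \<noteq> 0" and prim: "primitive_root g"
  shows "quad_char g = - 1"
proof (rule ccontr)
  assume neg: "quad_char g \<noteq> - 1"
  have range: "range (\<lambda>n::int. g powi n) = UNIV - {0}" using prim by (simp add: primitive_root_def)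
  have "g = g powi 1" by simp
  then have "g \<noteq> 0" using range by blast
  then have "quad_char g = 1" using neg quad_char_cases[of g] by auto
  then obtain s where s: "s \<noteq> 0" "g = s ^ 2" by (rule quad_char_eq_1E)
  have "quad_char a \<noteq> - 1" for a :: 'k
  proof
    assume a: "quad_char a = - 1"
    then have "a \<in> range (\<lambda>n::int. g powi n)" unfolding range by auto
    then obtain n :: int where "a = g powi n" by blast
    then have "a = (s powi n) ^ 2"
      by (simp add: s power2_eq_square power_int_mult_distrib)
    then show False using a s by simp
  qed
  then have "CARD('k) - 1 = 0" using card_quad_char_eq(2)[where 'k='k, OF two] by simp
  moreover have "card {0, 1::'k} \<le> CARD('k)" by (intro card_mono) auto
  ultimately show False by simp
qed

lemma legendre_char_eq_quad_char:
  fixes a :: "'p::prime_card mod_ring"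
  shows "legendre_char a = quad_char a"
proof -
  let ?p = "int CARD('p)"
  have cong: "[m = n] (mod ?p) \<longleftrightarrow> (of_int m :: 'p mod_ring) = of_int n" for m n :: int
    by (simp add: of_int_of_int_mod_ring cong_def of_int_mod_ring_def Abs_mod_ring_inject)
  have inv: "(of_int (to_int_mod_ring b) :: 'p mod_ring) = b" for b
    by (simp add: of_int_of_int_mod_ring)
  have "[to_int_mod_ring a = 0] (mod ?p) \<longleftrightarrow> a = 0" by (simp add: cong inv)
  moreover have "QuadRes ?p (to_int_mod_ring a) \<longleftrightarrow> (\<exists>b. a = b ^ 2)"
    unfolding QuadRes_def cong by (metis inv of_int_power)
  ultimately show ?thesis by (simp add: legendre_char_def Legendre_def quad_char_def)
qed

lemma mod_ring_two_neq_0: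
  assumes "CARD('p::prime_card) > 2"
  shows "(2 :: 'p mod_ring) \<noteq> 0"
proof
  assume "(2 :: 'p mod_ring) = 0"
  then have "(of_nat 2 :: 'p mod_ring) = 0" by simp
  then have "CARD('p) dvd 2" by (simp only: of_nat_0_mod_ring_dvd)
  then show False using assms by (auto dest: dvd_imp_le)
qed

theorem theorem6p3:
  fixes \<gamma> :: "'p::prime_card mod_ring"
    and l :: nat and t :: int
  assumes l_def: "l = CARD('p)"
    and l_odd: "l > 2"
    and prim: "primitive_root \<gamma>"
    and t_def: "t = frobenius_trace (smooth_model \<gamma>)"
  shows
    "(\<forall>N::int. of_int N \<noteq> (0 :: 'p mod_ring) \<longrightarrow>
        real (card (two_target \<gamma> (\<gamma> ^ 2) (of_int N))) =
          (if nonzero_square (4 * \<gamma> * of_int N)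
           then (3 * real l + 1 + of_int t - 2 * of_int (legendre_char (1 - \<gamma>))) / 4
           else (3 * real l + 1 - of_int t + 2 * of_int (legendre_char (\<gamma> - 1))) / 4)) \<and>
     (\<exists>u v::nat.
        (\<forall>N::'p mod_ring. N \<noteq> 0 \<longrightarrow>
           card (two_target \<gamma> (\<gamma> ^ 2) N) = (if nonzero_square (4 * \<gamma> * N) then u else v)) \<and>
        (\<lambda>N. card (two_target \<gamma> (\<gamma> ^ 2) N)) ` (UNIV - {0}) = {u, v} \<and>
        card {N::'p mod_ring. N \<noteq> 0 \<and> nonzero_square (4 * \<gamma> * N)} = (l - 1) div 2 \<and>
        card {N::'p mod_ring. N \<noteq> 0 \<and> \<not> nonzero_square (4 * \<gamma> * N)} = (l - 1) div 2 \<and>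
        (u \<noteq> v \<longleftrightarrow> t \<noteq> legendre_char (1 - \<gamma>) + legendre_char (\<gamma> - 1)))"
proof -
  let ?F = "UNIV :: 'p mod_ring set"
  let ?W = "\<lambda>N. card (two_target \<gamma> (\<gamma> ^ 2) N)"
  let ?P = "{N. N \<noteq> 0 \<and> nonzero_square (4 * \<gamma> * N)}"
  let ?Q = "{N. N \<noteq> 0 \<and> \<not> nonzero_square (4 * \<gamma> * N)}"
  have two: "(2 :: 'p mod_ring) \<noteq> 0" using mod_ring_two_neq_0 l_def l_odd by blast
  have g: "quad_char \<gamma> = - 1" by (rule primitive_root_nonsquare[OF two prim])
  have cardF: "CARD('p mod_ring) = l" by (simp add: l_def)
  have size: "4 * int (?W N) =
      (if nonzero_square (4 * \<gamma> * N)
       then 3 * int l + 1 + t - 2 * legendre_char (1 - \<gamma>)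
       else 3 * int l + 1 - t + 2 * legendre_char (\<gamma> - 1))" if "N \<noteq> 0" for N
    using card_two_target[OF two g that t_def]
    unfolding legendre_char_eq_quad_char cardF .
  have real_size: "real (?W N) =
      (if nonzero_square (4 * \<gamma> * N)
       then (3 * real l + 1 + of_int t - 2 * of_int (legendre_char (1 - \<gamma>))) / 4
       else (3 * real l + 1 - of_int t + 2 * of_int (legendre_char (\<gamma> - 1))) / 4)"
    if "N \<noteq> 0" for N
    using arg_cong[OF size[OF that], of real_of_int] by (auto split: if_splits)
  have g4: "4 * \<gamma> \<noteq> 0"
  proof -
    have "(2 :: 'p mod_ring) * 2 \<noteq> 0" using two by (intro no_zero_divisors)
    then have "(4 :: 'p mod_ring) \<noteq> 0" by simp
    then show ?thesis using g by auto
  qed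
  \<comment> \<open>\<open>N \<mapsto> 4 * \<gamma> * N\<close> permutes the field, so the two classes of \<open>N\<close> have the
    sizes of the sets of squares and of nonsquares.\<close>
  have card_class: "card {N. quad_char (4 * \<gamma> * N) = e} = card {a::'p mod_ring. quad_char a = e}" for e
    using g4 by (intro bij_betw_same_card[of "\<lambda>N. 4 * \<gamma> * N"]
        bij_betw_byWitness[where f' = "\<lambda>a. a / (4 * \<gamma>)"]) auto
  have P: "?P = {N. quad_char (4 * \<gamma> * N) = 1}" by (auto simp: nonzero_square_iff)
  have Q: "?Q = {N. quad_char (4 * \<gamma> * N) = - 1}"
  proof -
    have "N \<noteq> 0 \<and> quad_char (4 * \<gamma> * N) \<noteq> 1 \<longleftrightarrow> quad_char (4 * \<gamma> * N) = - 1" for N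
      using quad_char_cases[of "4 * \<gamma> * N"] g4 by auto
    then show ?thesis by (simp only: nonzero_square_iff)
  qed
  have cardP: "card ?P = (l - 1) div 2" and cardQ: "card ?Q = (l - 1) div 2"
    using card_quad_char_eq[OF two] unfolding P Q card_class cardF by auto
  obtain M M' where M: "M \<in> ?P" and M': "M' \<in> ?Q"
  proof -
    have "card ?P > 0" "card ?Q > 0" unfolding cardP cardQ using l_odd by auto
    then have "?P \<noteq> {}" "?Q \<noteq> {}" by (metis card.empty less_irrefl)+
    then show thesis using that by blast
  qed
  have W: "?W N = (if nonzero_square (4 * \<gamma> * N) then ?W M else ?W M')" if "N \<noteq> 0" for N
    using size[OF that] size[of M] size[of M'] M M' by (auto split: if_splits)
  have image: "?W ` (?F - {0}) = {?W M, ?W M'}"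
  proof
    show "?W ` (?F - {0}) \<subseteq> {?W M, ?W M'}" using W by auto
    show "{?W M, ?W M'} \<subseteq> ?W ` (?F - {0})" using M M' by blast
  qed
  have distinct: "?W M \<noteq> ?W M' \<longleftrightarrow> t \<noteq> legendre_char (1 - \<gamma>) + legendre_char (\<gamma> - 1)"
    using size[of M] size[of M'] M M' by auto
  show ?thesis
    by (intro conjI exI[of _ "?W M"] exI[of _ "?W M'"] allI impI
        real_size W image cardP cardQ distinct)
qed

end
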